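(* Let $\mathcal{P}_1(z)=\sum_{n\ge 0} |\mathcal{S}_n\cap Av(\mathbf{4123},\mathbf{1324})|\, z^n$ be the generating function for the permutation class $Av(\mathbf{4123},\mathbf{1324})$. Then $$\mathcal{P}_1(z) = \frac{2-13z+26z^2-17z^3+4z^4-z(1-2z-z^2)\sqrt{1-4z}}{2\sqrt{1-4z}\,(1-3z+z^2)^2}.$$
   Context: A permutation $\sigma$ contains a pattern $\pi$ if some subsequence of $\sigma$ is order-isomorphic to $\pi$; otherwise $\sigma$ avoids $\pi$. For a set $B$ of patterns, $Av(B)$ is the set of permutations avoiding every element of $B$, and $\mathcal{S}_n$ is the set of permutations of length $n$ (the empty permutation is counted for $n=0$). *)

theory Defs
  imports
    "HOL-Computational_Algebra.Computational_Algebra"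
    "HOL-Combinatorics.Multiset_Permutations"
    "HOL-Library.Sublist"
begin

text \<open>
  A permutation of length \<open>n\<close> is its one-line notation, a list in which each of \<open>1, \<dots>, n\<close>
  occurs exactly once; the empty list is the permutation of length \<open>0\<close>.
\<close>

definition perms_of_length :: "nat \<Rightarrow> nat list set" where
  "perms_of_length n = permutations_of_set {1..n}"

definition order_isomorphic :: "nat list \<Rightarrow> nat list \<Rightarrow> bool" where
  "order_isomorphic xs ys \<longleftrightarrow> length xs = length ys \<and>
     (\<forall>i < length xs. \<forall>j < length xs. xs ! i < xs ! j \<longleftrightarrow> ys ! i < ys ! j)"

text \<open>Subsequences need not be contiguous, which is what \<^const>\<open>subseq\<close> expresses.\<close>

definition contains_pattern :: "nat list \<Rightarrow> nat list \<Rightarrow> bool" where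
  "contains_pattern \<sigma> \<pi> \<longleftrightarrow> (\<exists>xs. subseq xs \<sigma> \<and> order_isomorphic xs \<pi>)"

definition Av :: "nat list set \<Rightarrow> nat list set" where
  "Av B = {\<sigma>. (\<exists>n. \<sigma> \<in> perms_of_length n) \<and> (\<forall>\<pi>\<in>B. \<not> contains_pattern \<sigma> \<pi>)}"

definition class_gf :: "nat list set \<Rightarrow> real fps" where
  "class_gf C = Abs_fps (\<lambda>n. real (card (perms_of_length n \<inter> C)))"

text \<open>
  The power series of \<open>sqrt (1 - 4 z)\<close> around \<open>0\<close>. Passing \<^const>\<open>root\<close> to \<^const>\<open>fps_radical\<close>
  selects the square root with constant term \<open>root 2 1 = 1\<close>.
\<close>

definition sqrt_one_minus_4z :: "real fps" where
  "sqrt_one_minus_4z = fps_radical root 2 (1 - 4 * fps_X)"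

end

theory Submission
  imports Defs
begin

text \<open>
  Build the permutations by inserting a new maximum \<open>N\<close>. A site \<open>xs | ys\<close> of \<open>xs @ ys\<close> admits \<open>N\<close>
  iff \<open>xs\<close> avoids 132 and \<open>ys\<close> avoids 123, so the admissible sites form an interval: they are the
  sites of a factor \<open>W\<close> of the permutation \<open>P @ W @ Q\<close>. This window avoids 123 and 132, hence is a skew
  sum of blocks, each a decreasing run followed by an element above the run. After an insertion the
  new window consists of the longest decreasing run ending at the site, of \<open>N\<close>, and of the longest
  factor starting at the site that lies below everything to the left of the site. The number of
  descendants of a permutation therefore depends only on the block lengths, plus one further length
  if \<open>P\<close> is nonempty. The resulting infinite linear system of generating functions has a unique
  solution, which is a combination of powers of \<open>1 / (1 - z)\<close>, \<open>1 / (1 - 2z)\<close> and the Catalan series;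
  the theorem is its value at the empty label.
\<close>

section \<open>Insertion of a new maximum\<close>

definition no123 :: "nat list \<Rightarrow> bool" where
  "no123 xs \<longleftrightarrow> (\<forall>a b c. subseq [a, b, c] xs \<longrightarrow> \<not> (a < b \<and> b < c))"

definition no132 :: "nat list \<Rightarrow> bool" where
  "no132 xs \<longleftrightarrow> (\<forall>a b c. subseq [a, b, c] xs \<longrightarrow> \<not> (a < c \<and> c < b))"

definition no4123 :: "nat list \<Rightarrow> bool" where
  "no4123 xs \<longleftrightarrow> (\<forall>a b c d. subseq [a, b, c, d] xs \<longrightarrow> \<not> (b < c \<and> c < d \<and> d < a))"

definition no1324 :: "nat list \<Rightarrow> bool" where
  "no1324 xs \<longleftrightarrow> (\<forall>a b c d. subseq [a, b, c, d] xs \<longrightarrow> \<not> (a < c \<and> c < b \<and> b < d))"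

section \<open>Subsequences of a list with one inserted entry\<close>

lemma subseq_insert_iff:
  "subseq p (xs @ N # ys) \<longleftrightarrow>
     subseq p (xs @ ys) \<or> (\<exists>p1 p2. p = p1 @ N # p2 \<and> subseq p1 xs \<and> subseq p2 ys)"
  (is "?l \<longleftrightarrow> ?r")
proof
  assume ?l
  then obtain p1 p2 where p: "p = p1 @ p2" "subseq p1 xs" "subseq p2 (N # ys)"
    by (auto elim: subseq_appendE)
  show ?r
  proof (cases "subseq p2 ys")
    case True
    then show ?thesis using p by (auto intro: list_emb_append_mono)
  next
    case False
    then obtain p3 where "p2 = N # p3" "subseq p3 ys"
      using p(3) by (cases p2) (auto split: if_splits)
    then show ?thesis using p by auto
  qed
next
  assume ?r
  then show ?l
  proof (elim disjE exE conjE)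
    assume "subseq p (xs @ ys)"
    moreover have "subseq (xs @ ys) (xs @ N # ys)" by (simp add: subseq_append' list_emb_Cons)
    ultimately show ?l using subseq_order.trans by blast
  next
    fix p1 p2 assume "p = p1 @ N # p2" "subseq p1 xs" "subseq p2 ys"
    then show ?l by (auto intro!: list_emb_append_mono)
  qed
qed

lemma subseq_insertI: "subseq p (xs @ ys) \<Longrightarrow> subseq p (xs @ N # ys)"
  by (simp add: subseq_insert_iff)

lemma subseq_insert_short_iff:
  shows "subseq [a, b, c] (xs @ N # ys) \<longleftrightarrow> subseq [a, b, c] (xs @ ys) \<or>
      a = N \<and> subseq [b, c] ys \<or> b = N \<and> subseq [a] xs \<and> subseq [c] ys \<or> c = N \<and> subseq [a, b] xs"
   and "subseq [a, b, c, d] (xs @ N # ys) \<longleftrightarrow> subseq [a, b, c, d] (xs @ ys) \<or>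
      a = N \<and> subseq [b, c, d] ys \<or> b = N \<and> subseq [a] xs \<and> subseq [c, d] ys \<or>
      c = N \<and> subseq [a, b] xs \<and> subseq [d] ys \<or> d = N \<and> subseq [a, b, c] xs"
  unfolding subseq_insert_iff Cons_eq_append_conv append_eq_Cons_conv by auto

lemma subseq_set: "subseq xs ys \<Longrightarrow> set xs \<subseteq> set ys"
  by (metis subseq_conv_nths set_nths_subset)

lemma subseq_insert_le:
  fixes N :: nat
  assumes "\<forall>x\<in>set (xs @ ys). x < N" and "subseq p (xs @ N # ys)" and "x \<in> set p"
  shows "x \<le> N"
proof -
  have "x \<in> set (xs @ N # ys)" using subseq_set assms(2,3) by blast
  then show ?thesis using assms(1) by (auto intro: less_imp_le)
qed

lemma sorted_wrt_ge_iff_subseq: "sorted_wrt (\<ge>) xs \<longleftrightarrow> (\<forall>b c. subseq [b, c] xs \<longrightarrow> \<not> b < c)"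
  for xs :: "nat list"
proof (induction xs)
  case (Cons x xs)
  then show ?case
    by (auto simp: subseq_singleton_left not_less split: if_splits dest: subseq_Cons' intro: list_emb_Cons)
      (metis subseq_Cons' subseq_singleton_left)
qed auto

text \<open>As \<open>N\<close> exceeds all other entries, it can only play the largest letter of a
  pattern. A new occurrence therefore consists of \<open>N\<close> and the remaining letters, split
  at the site. The same argument serves the next three lemmas.\<close>

lemma no123_insert_max:
  assumes lt: "\<forall>x\<in>set (xs @ ys). x < N"
  shows "no123 (xs @ N # ys) \<longleftrightarrow> no123 (xs @ ys) \<and> sorted_wrt (\<ge>) xs"
proof
  assume L: "no123 (xs @ N # ys)"
  have "no123 (xs @ ys)"
    using L unfolding no123_def by (meson subseq_insertI)
  moreover have "sorted_wrt (\<ge>) xs"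
    unfolding sorted_wrt_ge_iff_subseq
  proof (intro allI impI notI ballI)
    fix a b assume s: "subseq [a, b] xs" and o: "a < b"
    then have "b < N" using lt by (auto dest!: subseq_set)
    moreover have "subseq [a, b, N] (xs @ N # ys)" using s by (simp add: subseq_insert_short_iff)
    ultimately show False using L o unfolding no123_def by blast
  qed
  ultimately show "no123 (xs @ ys) \<and> sorted_wrt (\<ge>) xs" ..
next
  assume R: "no123 (xs @ ys) \<and> sorted_wrt (\<ge>) xs"
  show "no123 (xs @ N # ys)"
    unfolding no123_def
  proof (intro allI impI notI)
    fix a b c assume s: "subseq [a, b, c] (xs @ N # ys)" and o: "a < b \<and> b < c"
    have "c \<le> N" using subseq_insert_le[OF lt s, of c] by simp
    with o have "a \<noteq> N" "b \<noteq> N" by auto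
    with s have "subseq [a, b, c] (xs @ ys) \<or> subseq [a, b] xs"
      unfolding subseq_insert_short_iff by blast
    with R o show False unfolding no123_def sorted_wrt_ge_iff_subseq by blast
  qed
qed

lemma no132_insert_max:
  assumes lt: "\<forall>x\<in>set (xs @ ys). x < N"
  shows "no132 (xs @ N # ys) \<longleftrightarrow> no132 (xs @ ys) \<and> (\<forall>x\<in>set xs. \<forall>y\<in>set ys. y \<le> x)"
proof
  assume L: "no132 (xs @ N # ys)"
  have "no132 (xs @ ys)"
    using L unfolding no132_def by (meson subseq_insertI)
  moreover have "\<forall>x\<in>set xs. \<forall>y\<in>set ys. y \<le> x"
  proof (intro ballI leI notI)
    fix x y assume s: "x \<in> set xs" "y \<in> set ys" and o: "x < y"
    have "y < N" using lt s by auto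
    moreover have "subseq [x, N, y] (xs @ N # ys)"
      using s by (simp add: subseq_insert_short_iff subseq_singleton_left)
    ultimately show False using L o unfolding no132_def by blast
  qed
  ultimately show "no132 (xs @ ys) \<and> (\<forall>x\<in>set xs. \<forall>y\<in>set ys. y \<le> x)" ..
next
  assume R: "no132 (xs @ ys) \<and> (\<forall>x\<in>set xs. \<forall>y\<in>set ys. y \<le> x)"
  show "no132 (xs @ N # ys)"
    unfolding no132_def
  proof (intro allI impI notI)
    fix a b c assume s: "subseq [a, b, c] (xs @ N # ys)" and o: "a < c \<and> c < b"
    have "b \<le> N" using subseq_insert_le[OF lt s, of b] by simp
    with o have "a \<noteq> N" "c \<noteq> N" by auto
    with s have "subseq [a, b, c] (xs @ ys) \<or> a \<in> set xs \<and> c \<in> set ys"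
      unfolding subseq_insert_short_iff subseq_singleton_left by blast
    with R o show False unfolding no132_def by (meson not_less)
  qed
qed

lemma no4123_insert_max:
  assumes lt: "\<forall>x\<in>set (xs @ ys). x < N"
  shows "no4123 (xs @ N # ys) \<longleftrightarrow> no4123 (xs @ ys) \<and> no123 ys"
proof
  assume L: "no4123 (xs @ N # ys)"
  have "no4123 (xs @ ys)"
    using L unfolding no4123_def by (meson subseq_insertI)
  moreover have "no123 ys"
    unfolding no123_def
  proof (intro allI impI notI ballI)
    fix b c d assume s: "subseq [b, c, d] ys" and o: "b < c \<and> c < d"
    then have "d < N" using lt by (auto dest!: subseq_set)
    moreover have "subseq [N, b, c, d] (xs @ N # ys)" using s by (simp add: subseq_insert_short_iff)
    ultimately show False using L o unfolding no4123_def by blast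
  qed
  ultimately show "no4123 (xs @ ys) \<and> no123 ys" ..
next
  assume R: "no4123 (xs @ ys) \<and> no123 ys"
  show "no4123 (xs @ N # ys)"
    unfolding no4123_def
  proof (intro allI impI notI)
    fix a b c d assume s: "subseq [a, b, c, d] (xs @ N # ys)" and o: "b < c \<and> c < d \<and> d < a"
    have "a \<le> N" using subseq_insert_le[OF lt s, of a] by simp
    with o have "b \<noteq> N" "c \<noteq> N" "d \<noteq> N" by auto
    with s have "subseq [a, b, c, d] (xs @ ys) \<or> subseq [b, c, d] ys"
      unfolding subseq_insert_short_iff by blast
    with R o show False unfolding no4123_def no123_def by blast
  qed
qed

lemma no1324_insert_max:
  assumes lt: "\<forall>x\<in>set (xs @ ys). x < N"
  shows "no1324 (xs @ N # ys) \<longleftrightarrow> no1324 (xs @ ys) \<and> no132 xs"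
proof
  assume L: "no1324 (xs @ N # ys)"
  have "no1324 (xs @ ys)"
    using L unfolding no1324_def by (meson subseq_insertI)
  moreover have "no132 xs"
    unfolding no132_def
  proof (intro allI impI notI ballI)
    fix a b c assume s: "subseq [a, b, c] xs" and o: "a < c \<and> c < b"
    then have "b < N" using lt by (auto dest!: subseq_set)
    moreover have "subseq [a, b, c, N] (xs @ N # ys)" using s by (simp add: subseq_insert_short_iff)
    ultimately show False using L o unfolding no1324_def by blast
  qed
  ultimately show "no1324 (xs @ ys) \<and> no132 xs" ..
next
  assume R: "no1324 (xs @ ys) \<and> no132 xs"
  show "no1324 (xs @ N # ys)"
    unfolding no1324_def
  proof (intro allI impI notI)
    fix a b c d assume s: "subseq [a, b, c, d] (xs @ N # ys)" and o: "a < c \<and> c < b \<and> b < d"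
    have "d \<le> N" using subseq_insert_le[OF lt s, of d] by simp
    with o have "a \<noteq> N" "b \<noteq> N" "c \<noteq> N" by auto
    with s have "subseq [a, b, c, d] (xs @ ys) \<or> subseq [a, b, c] xs"
      unfolding subseq_insert_short_iff by blast
    with R o show False unfolding no1324_def no132_def by blast
  qed
qed

section \<open>From pattern containment to the list predicates\<close>

lemma contains_pattern_length_4_iff:
  assumes "length p = 4"
  shows "contains_pattern s p \<longleftrightarrow> (\<exists>a b c d. subseq [a, b, c, d] s \<and> order_isomorphic [a, b, c, d] p)"
proof -
  have "\<exists>a b c d. xs = [a, b, c, d]" if "order_isomorphic xs p" for xs
    using that assms by (auto simp: order_isomorphic_def length_Suc_conv eval_nat_numeral)
  then show ?thesis
    unfolding contains_pattern_def by blast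
qed

lemma contains_4123_iff: "contains_pattern s [4,1,2,3] \<longleftrightarrow> \<not> no4123 s"
proof -
  have "order_isomorphic [a,b,c,d] [4,1,2,3] \<longleftrightarrow> b < c \<and> c < d \<and> d < a" for a b c d
    unfolding order_isomorphic_def by (simp add: All_less_Suc2) linarith
  then show ?thesis by (simp add: contains_pattern_length_4_iff no4123_def) blast
qed

lemma contains_1324_iff: "contains_pattern s [1,3,2,4] \<longleftrightarrow> \<not> no1324 s"
proof -
  have "order_isomorphic [a,b,c,d] [1,3,2,4] \<longleftrightarrow> a < c \<and> c < b \<and> b < d" for a b c d
    unfolding order_isomorphic_def by (simp add: All_less_Suc2) linarith
  then show ?thesis by (simp add: contains_pattern_length_4_iff no1324_def) blast
qed

section \<open>Counting avoiders by insertions\<close>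

definition active :: "nat list \<Rightarrow> nat list \<Rightarrow> bool" where
  "active xs ys \<longleftrightarrow> no132 xs \<and> no123 ys"

definition insert_max :: "nat list \<Rightarrow> nat list \<Rightarrow> nat list" where
  "insert_max xs ys = xs @ Suc (length (xs @ ys)) # ys"

text \<open>
  \<open>descendants n s\<close> counts the avoiders obtained from \<open>s\<close> by \<open>n\<close> insertions of a new maximum.
\<close>

primrec descendants :: "nat \<Rightarrow> nat list \<Rightarrow> nat" where
  "descendants 0 s = 1"
| "descendants (Suc n) s =
    (\<Sum>i \<in> {i. i \<le> length s \<and> active (take i s) (drop i s)}.
       descendants n (insert_max (take i s) (drop i s)))"

abbreviation avoiders :: "nat \<Rightarrow> nat list set" where
  "avoiders n \<equiv> perms_of_length n \<inter> Av {[4,1,2,3], [1,3,2,4]}"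

lemma avoiders_eq: "avoiders n = {s. s \<in> perms_of_length n \<and> no4123 s \<and> no1324 s}"
  by (auto simp: Av_def contains_4123_iff contains_1324_iff simp del: One_nat_def)

lemma perms_of_lengthD:
  assumes "s \<in> perms_of_length n"
  shows "length s = n" "distinct s" "set s = {1..n}"
  using assms by (auto simp: perms_of_length_def permutations_of_set_def distinct_card[symmetric])

lemma insert_max_avoiders_iff:
  assumes "length (xs @ ys) = n"
  shows "insert_max xs ys \<in> avoiders (Suc n) \<longleftrightarrow> xs @ ys \<in> avoiders n \<and> active xs ys"
proof -
  have "insert_max xs ys \<in> perms_of_length (Suc n) \<longleftrightarrow> xs @ ys \<in> perms_of_length n"
    (is "?l \<longleftrightarrow> ?r")
  proof
    assume ?r
    from perms_of_lengthD(3)[OF this] have "Suc n \<notin> set (xs @ ys)" by simp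
    then show ?l
      using perms_of_lengthD[OF \<open>?r\<close>] assms
      unfolding perms_of_length_def permutations_of_set_def insert_max_def by (auto simp: atLeastAtMostSuc_conv)
  next
    assume l: ?l
    have "set (insert_max xs ys) = {1..Suc n}" "Suc n \<notin> set (xs @ ys)"
      using perms_of_lengthD[OF l] assms by (auto simp: insert_max_def)
    moreover have "set (insert_max xs ys) = insert (Suc n) (set (xs @ ys))"
      using assms by (auto simp: insert_max_def)
    ultimately have "set (xs @ ys) = {1..Suc n} - {Suc n}" by blast
    also have "\<dots> = {1..n}" by auto
    finally have "set (xs @ ys) = {1..n}" .
    then show ?r
      using perms_of_lengthD[OF l] unfolding perms_of_length_def permutations_of_set_def insert_max_def by auto
  qed
  moreover have "no4123 (insert_max xs ys) \<and> no1324 (insert_max xs ys) \<longleftrightarrow>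
      no4123 (xs @ ys) \<and> no1324 (xs @ ys) \<and> active xs ys" if "xs @ ys \<in> perms_of_length n"
  proof -
    have lt: "\<forall>x\<in>set (xs @ ys). x < Suc n"
      using perms_of_lengthD[OF that] by auto
    show ?thesis
      unfolding insert_max_def assms no4123_insert_max[OF lt] no1324_insert_max[OF lt] active_def by blast
  qed
  ultimately show ?thesis
    unfolding avoiders_eq by blast
qed

text \<open>Deleting the maximum inverts the insertion, so each avoider of length
  \<open>Suc n\<close> comes from exactly one parent and one site; the sum over such pairs is
  reindexed by this bijection.\<close>

lemma sum_descendants:
  "(\<Sum>s\<in>avoiders n. descendants (Suc m) s) = (\<Sum>s\<in>avoiders (Suc n). descendants m s)"
proof -
  let ?A = "\<lambda>s. {i. i \<le> length s \<and> active (take i s) (drop i s)}"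
  let ?f = "\<lambda>(s, i). insert_max (take i s) (drop i s)"
  have fin: "finite (avoiders n)" by (auto simp: perms_of_length_def)
  have bij: "bij_betw ?f (Sigma (avoiders n) ?A) (avoiders (Suc n))"
  proof (rule bij_betw_imageI)
    show "inj_on ?f (Sigma (avoiders n) ?A)"
    proof (rule inj_onI, clarsimp simp del: append_take_drop_id)
      fix s i s' i'
      assume s: "s \<in> perms_of_length n" "s' \<in> perms_of_length n" and i: "i \<le> length s" "i' \<le> length s'"
        and eq: "insert_max (take i s) (drop i s) = insert_max (take i' s') (drop i' s')"
      have len: "length s = n" "length s' = n" and "Suc n \<notin> set s" "Suc n \<notin> set s'"
        using perms_of_lengthD s by auto
      \<comment> \<open>\<open>Suc n\<close> occurs in neither parent, so its position in the common
        child fixes both halves.\<close>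
      then have "take i s = take i' s' \<and> drop i s = drop i' s'"
        using eq unfolding insert_max_def append_take_drop_id len
        by (subst (asm) append_Cons_eq_iff) (auto dest: in_set_takeD in_set_dropD)
      then show "s = s' \<and> i = i'"
        by (metis append_take_drop_id i length_take min.absorb2)
    qed
    show "?f ` Sigma (avoiders n) ?A = avoiders (Suc n)"
    proof (intro equalityI subsetI)
      fix t assume "t \<in> ?f ` Sigma (avoiders n) ?A"
      then obtain s i where s: "s \<in> avoiders n" "active (take i s) (drop i s)"
        and t: "t = insert_max (take i s) (drop i s)" by auto
      from s(1) have "s \<in> perms_of_length n" by blast
      then have "length (take i s @ drop i s) = n" by (simp add: perms_of_lengthD)
      from insert_max_avoiders_iff[OF this] show "t \<in> avoiders (Suc n)"
        using s unfolding t append_take_drop_id by blast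
    next
      fix t assume t: "t \<in> avoiders (Suc n)"
      then have "t \<in> perms_of_length (Suc n)" by blast
      note pt = perms_of_lengthD[OF this]
      then have "Suc n \<in> set t" by simp
      then obtain xs ys where xy: "t = xs @ Suc n # ys" by (meson split_list)
      with pt have "t = insert_max xs ys" "length (xs @ ys) = n" by (auto simp: insert_max_def)
      with t have "xs @ ys \<in> avoiders n" "active xs ys" using insert_max_avoiders_iff by blast+
      then have "(xs @ ys, length xs) \<in> Sigma (avoiders n) ?A" by simp
      moreover have "?f (xs @ ys, length xs) = t" using \<open>t = insert_max xs ys\<close> by simp
      ultimately show "t \<in> ?f ` Sigma (avoiders n) ?A" by blast
    qed
  qed
  have "(\<Sum>s\<in>avoiders n. descendants (Suc m) s) = (\<Sum>s\<in>avoiders n. \<Sum>i\<in>?A s. descendants m (?f (s, i)))"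
    by (simp only: descendants.simps prod.case)
  also have "\<dots> = (\<Sum>p\<in>Sigma (avoiders n) ?A. descendants m (?f p))"
    by (subst sum.Sigma) (use fin in \<open>auto simp: case_prod_beta\<close>)
  also have "\<dots> = (\<Sum>s\<in>avoiders (Suc n). descendants m s)"
    by (rule sum.reindex_bij_betw[OF bij])
  finally show ?thesis .
qed

lemma card_avoiders: "card (avoiders n) = descendants n []"
proof -
  \<comment> \<open>Of \<open>k + m\<close> insertions, \<open>k\<close> are moved from the counting
    function into the set; once all are moved, the summand is the constant 1.\<close>
  have "(\<Sum>s\<in>avoiders 0. descendants (k + m) s) = (\<Sum>s\<in>avoiders k. descendants m s)" for k m
    by (induction k arbitrary: m) (simp_all only: sum_descendants[symmetric] add_Suc_shift add_0)
  from this[of n 0] have "(\<Sum>s\<in>avoiders 0. descendants n s) = card (avoiders n)" by simp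
  moreover have "avoiders 0 = {[]}"
    unfolding avoiders_eq by (auto simp: perms_of_length_def permutations_of_set_def no4123_def no1324_def)
  ultimately show ?thesis by simp
qed

section \<open>The linear system and its solution\<close>

abbreviation X :: "real fps" where "X \<equiv> fps_X"

definition rho :: "real fps" where "rho = inverse (1 - 2 * X)"
definition mu :: "real fps" where "mu = inverse (1 - X)"
text \<open>The normalisation forced by \<open>zgf_eq\<close>.\<close>

definition kap :: "real fps" where "kap = (1 - 2 * X) * inverse (2 * (1 - 3 * X + X^2))"
text \<open>The Catalan series \<open>(1 - sqrt (1 - 4 z)) / (2 z)\<close>; the shift divides by
  \<open>z\<close>, the constant term being 0.\<close>

definition cat :: "real fps" where "cat = fps_shift 1 (fps_const (1/2) * (1 - sqrt_one_minus_4z))"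
text \<open>Forced by \<open>bgf_eq\<close>: comparing the terms in \<open>rho ^ ell E\<close> gives
  \<open>theta\<close>, comparing those free of \<open>E\<close> gives \<open>alpha\<close>.\<close>

definition theta :: "real fps" where "theta = kap^2 * (1 - 2 * X) * inverse (1 - 4 * X)"
definition alpha :: "real fps" where "alpha = 1 - theta - kap^2 * (3 - 2 * X)"

text \<open>Division-free forms of the definitions, from which \<open>algebra\<close> derives the
  later identities by ideal membership.\<close>

lemma rho: "(1 - 2 * X) * rho = 1" and mu: "(1 - X) * mu = 1"
  and kap: "2 * (1 - 3 * X + X^2) * kap = 1 - 2 * X"
  and theta: "(1 - 4 * X) * theta = kap^2 * (1 - 2 * X)"
proof -
  show "(1 - 2 * X) * rho = 1" "(1 - X) * mu = 1"
    unfolding rho_def mu_def by (rule inverse_mult_eq_1', simp)+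
  have *: "2 * (1 - 3 * X + X^2) * inverse (2 * (1 - 3 * X + X^2)) = 1"
    by (rule inverse_mult_eq_1') simp
  show "2 * (1 - 3 * X + X^2) * kap = 1 - 2 * X"
    unfolding kap_def using * by algebra
  have *: "(1 - 4 * X) * inverse (1 - 4 * X) = 1"
    by (rule inverse_mult_eq_1') simp
  show "(1 - 4 * X) * theta = kap^2 * (1 - 2 * X)"
    unfolding theta_def using * by algebra
qed

lemma sqrt_one_minus_4z_square: "sqrt_one_minus_4z^2 = 1 - 4 * X"
proof -
  have "fps_radical root (Suc 1) (1 - 4 * X) ^ Suc 1 = 1 - 4 * X"
    by (subst power_radical[symmetric]) auto
  then show ?thesis by (simp add: sqrt_one_minus_4z_def numeral_2_eq_2)
qed

lemma sqrt_one_minus_4z_nth_0: "sqrt_one_minus_4z $ 0 = 1"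
  by (simp add: sqrt_one_minus_4z_def numeral_2_eq_2)

lemma sqrt_eq_cat: "sqrt_one_minus_4z = 1 - 2 * X * cat"
proof -
  have "X * cat = fps_const (1/2) * (1 - sqrt_one_minus_4z)"
    unfolding cat_def by (rule fps_ext) (simp add: sqrt_one_minus_4z_nth_0)
  moreover have "2 * fps_const (1/2) = (1 :: real fps)"
    by (simp add: numeral_fps_const flip: fps_const_mult)
  ultimately show ?thesis by algebra
qed

lemma cat: "X * cat^2 = cat - 1"
proof -
  \<comment> \<open>Squaring \<open>1 - 2 * X * cat\<close> yields the Catalan equation times
    \<open>4 * X\<close>, which is then cancelled.\<close>
  have "(4 * X) * (X * cat^2) = (4 * X) * (cat - 1)"
    using sqrt_one_minus_4z_square sqrt_eq_cat by algebra
  then show ?thesis by (simp del: mult.assoc)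
qed

text \<open>
  A list \<open>E\<close> stands for a skew sum of blocks: the entry \<open>d\<close> is a decreasing run of length \<open>d\<close> followed
  by an element above the run, so that \<open>0\<close> is a single element. The functions below are the
  statistics of \<open>E\<close> on which the generating functions depend; \<open>ell E\<close> is the number of elements before
  the first one that tops a nonempty run.
\<close>

fun ell :: "nat list \<Rightarrow> nat" where
  "ell [] = 0" | "ell (0 # E) = Suc (ell E)" | "ell (Suc l # E) = Suc l"

fun rr :: "nat list \<Rightarrow> real fps" where
  "rr [] = 0"
| "rr (0 # E) = mu * rr E"
| "rr (Suc l # E) = mu * (rho ^ Suc (ell E) + rr E - 1)"

fun ss :: "nat list \<Rightarrow> real fps" where
  "ss [] = 0"
| "ss (0 # E) = ss E"
| "ss (Suc l # E) = rho ^ Suc (ell E) + rr E - 1"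

text \<open>
  The solution of the linear system \<open>zgf_eq\<close>, \<open>cgf_eq\<close>, \<open>bgf_eq\<close>. It was found by solving the
  recurrences along a run, whose characteristic roots are \<open>rho\<close>, \<open>mu\<close> and \<open>cat\<close>.
  The functions \<open>crun\<close>, \<open>brun\<close> add up the children for the sites inside one run, and \<open>csum\<close>, \<open>bsum\<close>
  those for all sites at or to the right of a decreasing run of length \<open>k + 1\<close> (for \<open>c\<close>) or
  \<open>k\<close> (for \<open>b\<close>) that is followed by the blocks \<open>E\<close>.
\<close>

definition zgf :: "real fps" where "zgf = 2 * rho * (1 - X) * kap"

definition cgf :: "nat \<Rightarrow> nat list \<Rightarrow> real fps" where
  "cgf v E = kap * (rho ^ Suc v + rho ^ Suc (ell E) + rr E)"

definition bgf :: "nat list \<Rightarrow> real fps" where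
  "bgf E = alpha * cat ^ Suc (ell E) + 2 * theta * rho ^ ell E
     + 2 * kap^2 * (1 + rho * ((1 - X)^2 * rr E - X * ss E))"

fun crun :: "nat \<Rightarrow> nat \<Rightarrow> real fps" where
  "crun k 0 = cgf k []"
| "crun k (Suc l) = cgf k (replicate (Suc l) 0) + crun (Suc k) l"

fun brun :: "nat \<Rightarrow> nat \<Rightarrow> real fps" where
  "brun k 0 = bgf [k]"
| "brun k (Suc l) = bgf (k # replicate (Suc l) 0) + brun (Suc k) l"

fun csum :: "nat \<Rightarrow> nat list \<Rightarrow> real fps" where
  "csum k [] = cgf k []"
| "csum k (0 # E) = cgf k (0 # E) + csum (Suc k) E"
| "csum k (Suc l # E) = cgf k (Suc l # E) + crun (Suc k) l + csum 0 E"

fun bsum :: "nat \<Rightarrow> nat list \<Rightarrow> real fps" where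
  "bsum k [] = bgf [k]"
| "bsum k (0 # E) = bgf (k # 0 # E) + bsum (Suc k) E"
| "bsum k (Suc l # E) = bgf (k # Suc l # E) + brun (Suc k) l + csum 0 E"

section \<open>Closed forms of the sums and the linear system\<close>

lemma ell_replicate [simp]: "ell (replicate n 0) = n"
  and rr_replicate [simp]: "rr (replicate n 0) = 0"
  by (induction n) auto

lemma mult_two_cancel: "2 * a = 2 * b \<Longrightarrow> a = b" for a b :: "real fps"
  by simp

text \<open>Since \<open>2 * X * rho ^ Suc j = rho ^ Suc j - rho ^ j\<close>, both families of
  powers in the sum telescope.\<close>

lemma crun_eq: "2 * X * crun k l = kap * (rho ^ k + 1) * (rho ^ Suc l - 1)"
proof (induction l arbitrary: k)
  case 0
  \<comment> \<open>Here and below powers are abbreviated because \<open>algebra\<close> fails on \<open>rho * rho ^ k\<close> with symbolic \<open>k\<close>.\<close>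
  define p where "p = rho ^ k"
  show ?case
    unfolding crun.simps cgf_def ell.simps rr.simps power_Suc power_0 p_def[symmetric] using rho by algebra
next
  case (Suc l)
  define p p' where pow: "p = rho ^ k" "p' = rho ^ l"
  have "2 * X * crun k (Suc l) = 2 * X * cgf k (replicate (Suc l) 0) + 2 * X * crun (Suc k) l"
    by (simp add: algebra_simps)
  also have "\<dots> = kap * (rho ^ k + 1) * (rho ^ Suc (Suc l) - 1)"
    unfolding Suc.IH cgf_def ell_replicate rr_replicate power_Suc pow[symmetric] using rho by algebra
  finally show ?case .
qed

text \<open>Telescoping again. Only the sites up to the first top of a nonempty run feel
  \<open>k\<close>, as the counter restarts at 0 there; hence \<open>k\<close> meets
  \<open>E\<close> only through \<open>ell E\<close>.\<close>

lemma csum_eq: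
  "2 * X * csum k E = 2 * kap * (rho ^ Suc (ell E) + rr E - 1) + kap * (rho ^ k - 1) * (rho ^ Suc (ell E) - 1)"
proof (induction k E rule: csum.induct)
  case (1 k)
  define p where "p = rho ^ k"
  show ?case
    unfolding csum.simps cgf_def ell.simps rr.simps power_Suc power_0 p_def[symmetric] using rho by algebra
next
  case (2 k E)
  define p p' where pow: "p = rho ^ k" "p' = rho ^ ell E"
  have "2 * X * csum k (0 # E) = 2 * X * cgf k (0 # E) + 2 * X * csum (Suc k) E"
    by (simp add: algebra_simps)
  then show ?case
    unfolding 2 cgf_def ell.simps rr.simps power_Suc pow[symmetric] using rho mu by algebra
next
  case (3 k l E)
  define p p' p'' where pow: "p = rho ^ k" "p' = rho ^ ell E" "p'' = rho ^ l"
  have "2 * X * csum k (Suc l # E) = 2 * X * cgf k (Suc l # E) + 2 * X * crun (Suc k) l + 2 * X * csum 0 E"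
    by (simp add: algebra_simps)
  then show ?case
    unfolding 3 crun_eq cgf_def ell.simps rr.simps power_Suc power_0 pow[symmetric] using rho mu by algebra
qed

text \<open>First equation of the system: the 1 counts the node itself, \<open>X\<close> marks an
  insertion, and the summands are the children.\<close>

lemma zgf_eq: "zgf = 1 + X * (zgf + cgf 0 [])"
  unfolding zgf_def cgf_def ell.simps rr.simps power_Suc power_0 using rho kap by algebra

lemma cgf_eq: "cgf v E = 1 + X * (zgf + crun 0 v + csum 0 E)"
proof (rule mult_two_cancel)
  define p p' where pow: "p = rho ^ v" "p' = rho ^ ell E"
  have "2 * cgf v E = 2 + 2 * X * zgf + 2 * X * crun 0 v + 2 * X * csum 0 E"
    unfolding crun_eq csum_eq zgf_def cgf_def power_Suc power_0 pow[symmetric] using rho kap by algebra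
  then show "2 * cgf v E = 2 * (1 + X * (zgf + crun 0 v + csum 0 E))"
    by algebra
qed

lemma bgf_Suc: "bgf (Suc k # E) = alpha * cat ^ Suc (Suc k) + 2 * theta * rho ^ Suc k
    + 2 * kap^2 * (rho ^ Suc (ell E) + rr E)"
proof -
  define p p' q where pow: "p = rho ^ k" "p' = rho ^ ell E" "q = cat ^ k"
  \<comment> \<open>Here \<open>rr\<close> is \<open>mu\<close> times \<open>ss\<close>, so their
    contributions to \<open>bgf\<close> merge into one.\<close>
  have *: "(1 - X)^2 * (mu * t) - X * t = (1 - 2 * X) * t" for t
    using mu by algebra
  show ?thesis
    unfolding bgf_def ell.simps rr.simps ss.simps * power_Suc pow[symmetric] using rho by algebra
qed

text \<open>The powers of \<open>cat\<close> telescope as well, because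
  \<open>X * cat ^ Suc (Suc j) = cat ^ Suc j - cat ^ j\<close>.\<close>

lemma brun_eq: "X * brun (Suc k) l = alpha * (cat ^ (k + Suc l) - cat ^ k)
   + theta * (rho ^ (k + Suc l) - rho ^ k) + kap^2 * (rho ^ Suc l - 1)"
proof (induction l arbitrary: k)
  case 0
  define p q where pow: "p = rho ^ k" "q = cat ^ k"
  show ?case
    unfolding brun.simps bgf_Suc ell.simps rr.simps power_Suc power_0 power_add pow[symmetric]
    using rho cat by algebra
next
  case (Suc l)
  define p p' q q' where pow: "p = rho ^ k" "p' = rho ^ l" "q = cat ^ k" "q' = cat ^ l"
  have "X * brun (Suc k) (Suc l) = X * bgf (Suc k # replicate (Suc l) 0) + X * brun (Suc (Suc k)) l"
    by (simp add: algebra_simps)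
  then show ?case
    unfolding Suc.IH bgf_Suc ell_replicate rr_replicate power_Suc power_add pow[symmetric]
    using rho cat by algebra
qed

text \<open>The first summand stays unevaluated, since \<open>bgf_Suc\<close> does not cover
  \<open>k = 0\<close>. Later labels of kind \<open>bgf\<close> start with a nonempty run; the final
  \<open>csum 0\<close> contributes \<open>kap * ss E\<close>.\<close>

lemma bsum_eq: "X * bsum k E = X * bgf (k # E) + alpha * (cat ^ (k + ell E) - cat ^ k)
   + theta * (rho ^ (k + ell E) - rho ^ k) + kap^2 * (rho ^ Suc (ell E) - 1)
   + 2 * kap^2 * rr E + kap * (1 - 2 * kap) * ss E - 2 * kap^2 * X * (rho ^ Suc (ell E) + rr E)"
proof (induction k E rule: csum.induct)
  case (1 k)
  define p q where pow: "p = rho ^ k" "q = cat ^ k"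
  show ?case
    unfolding bsum.simps ell.simps rr.simps ss.simps power_Suc power_0 power_add pow[symmetric]
    using rho by algebra
next
  case (2 k E)
  define p p' q q' where pow: "p = rho ^ k" "p' = rho ^ ell E" "q = cat ^ k" "q' = cat ^ ell E"
  have "X * bsum k (0 # E) = X * bgf (k # 0 # E) + X * bsum (Suc k) E"
    by (simp add: algebra_simps)
  then show ?case
    unfolding 2 bgf_Suc ell.simps rr.simps ss.simps power_Suc power_add pow[symmetric]
    using rho mu cat by algebra
next
  case (3 k l E)
  define b where "b = bgf (k # Suc l # E)"
  define p p' p'' q q' where pow: "p = rho ^ k" "p' = rho ^ ell E" "p'' = rho ^ l" "q = cat ^ k" "q' = cat ^ l"
  have eq: "2 * (X * bsum k (Suc l # E)) = 2 * (X * bgf (k # Suc l # E) + X * brun (Suc k) l) + 2 * X * csum 0 E"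
    by (simp add: algebra_simps)
  show ?case
  proof (rule mult_two_cancel, goal_cases)
    case 1
    show ?case
      unfolding eq unfolding brun_eq csum_eq ell.simps rr.simps ss.simps power_Suc power_add power_0
        pow[symmetric] b_def[symmetric]
      using rho mu by algebra
  qed
qed

lemma bgf_eq: "bgf E = 1 + X * bsum 0 E"
proof -
  define p q where pow: "p = rho ^ ell E" "q = cat ^ ell E"
  have 0: "bgf (0 # E) = alpha * cat ^ Suc (Suc (ell E)) + 2 * theta * rho ^ Suc (ell E)
     + 2 * kap^2 * (1 + rho * ((1 - X) * rr E - X * ss E))"
    unfolding bgf_def ell.simps rr.simps ss.simps power_Suc using mu by algebra
  show ?thesis
    unfolding bsum_eq 0 unfolding bgf_def alpha_def power_Suc power_add power_0 pow[symmetric]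
    using rho cat kap theta by algebra
qed

section \<open>The value at the empty label\<close>

lemma bgf_Nil: "bgf [] * (2 * sqrt_one_minus_4z * (1 - 3 * X + X^2)^2) =
  2 - 13 * X + 26 * X^2 - 17 * X^3 + 4 * X^4 - X * (1 - 2 * X - X^2) * sqrt_one_minus_4z"
proof -
  have 1: "4 * (1 - 3 * X + X^2)^2 * kap^2 = (1 - 2 * X)^2" using kap by algebra
  have 2: "4 * (1 - 3 * X + X^2)^2 * sqrt_one_minus_4z^2 * theta = (1 - 2 * X)^3"
    using kap theta sqrt_one_minus_4z_square by algebra
  \<comment> \<open>The factor \<open>X\<close> turns \<open>cat\<close> into the square root; the
    extra root, together with the one in the denominator, clears \<open>1 - 4 * X\<close> from
    \<open>theta\<close>.\<close>
  have "(sqrt_one_minus_4z * X) * (2 * bgf [] * (2 * sqrt_one_minus_4z * (1 - 3 * X + X^2)^2)) =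
   (sqrt_one_minus_4z * X) * (2 * (2 - 13 * X + 26 * X^2 - 17 * X^3 + 4 * X^4 - X * (1 - 2 * X - X^2) * sqrt_one_minus_4z))"
    unfolding bgf_def alpha_def ell.simps rr.simps ss.simps power_Suc power_0
    using 1 2 sqrt_one_minus_4z_square sqrt_eq_cat by algebra
  moreover have "sqrt_one_minus_4z * X \<noteq> 0" using sqrt_one_minus_4z_nth_0 by auto
  ultimately have "2 * bgf [] * (2 * sqrt_one_minus_4z * (1 - 3 * X + X^2)^2) =
    2 * (2 - 13 * X + 26 * X^2 - 17 * X^3 + 4 * X^4 - X * (1 - 2 * X - X^2) * sqrt_one_minus_4z)"
    by (metis mult_left_cancel)
  then show ?thesis
    by (subst (asm) mult.assoc) (rule mult_two_cancel)
qed

lemma bgf_Nil_eq_quotient: "bgf [] =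
  (2 - 13 * X + 26 * X^2 - 17 * X^3 + 4 * X^4 - X * (1 - 2 * X - X^2) * sqrt_one_minus_4z)
  / (2 * sqrt_one_minus_4z * (1 - 3 * X + X^2)^2)"
proof -
  have "(2 * sqrt_one_minus_4z * (1 - 3 * X + X^2)^2) $ 0 \<noteq> 0"
    by (simp add: sqrt_one_minus_4z_nth_0 fps_power_zeroth)
  then have "2 * sqrt_one_minus_4z * (1 - 3 * X + X^2)^2 \<noteq> 0" by force
  then show ?thesis unfolding bgf_Nil[symmetric] by (rule nonzero_mult_div_cancel_right[symmetric])
qed

section \<open>The generating tree\<close>

abbreviation dec :: "nat list \<Rightarrow> bool" where "dec \<equiv> sorted_wrt (>)"

text \<open>A site is given by the length of its left part, so a window has one site more than
  entries. The bound on the entries makes the value inserted by \<open>insert_max\<close> a strict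
  maximum.\<close>

definition window :: "nat list \<Rightarrow> nat list \<Rightarrow> nat list \<Rightarrow> bool" where
  "window P W Q \<longleftrightarrow> (\<forall>x\<in>set (P @ W @ Q). x \<le> length (P @ W @ Q)) \<and>
     (\<forall>xs ys. xs @ ys = P @ W @ Q \<longrightarrow>
        (active xs ys \<longleftrightarrow> length P \<le> length xs \<and> length xs \<le> length (P @ W)))"

text \<open>Visits the sites from left to right, the order in which \<open>csum\<close> and
  \<open>bsum\<close> recurse.\<close>

fun walk :: "(nat list \<Rightarrow> nat list \<Rightarrow> 'a::comm_monoid_add) \<Rightarrow> nat list \<Rightarrow> nat list \<Rightarrow> 'a" where
  "walk f xs [] = f xs []"
| "walk f xs (y # ys) = f xs (y # ys) + walk f (xs @ [y]) ys"

lemma walk_eq_sum: "walk f xs ys = (\<Sum>i\<le>length ys. f (xs @ take i ys) (drop i ys))"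
  by (induction ys arbitrary: xs) (simp_all add: sum.atMost_Suc_shift del: sum.atMost_Suc)

lemma walk_append:
  "walk f xs (ys @ z # zs) = walk (\<lambda>as bs. f as (bs @ z # zs)) xs ys + walk f (xs @ ys @ [z]) zs"
  by (induction ys arbitrary: xs) (simp_all add: add.assoc)

definition child :: "nat \<Rightarrow> nat list \<Rightarrow> nat list \<Rightarrow> nat list \<Rightarrow> nat list \<Rightarrow> real" where
  "child n P Q xs ys = real (descendants n (insert_max (P @ xs) (ys @ Q)))"

lemma descendants_window:
  assumes "window P W Q"
  shows "real (descendants (Suc n) (P @ W @ Q)) = walk (child n P Q) [] W"
proof -
  let ?s = "P @ W @ Q"
  have "{i. i \<le> length ?s \<and> active (take i ?s) (drop i ?s)} = (+) (length P) ` {..length W}"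
  proof (intro equalityI subsetI)
    fix i assume "i \<in> {i. i \<le> length ?s \<and> active (take i ?s) (drop i ?s)}"
    then have "i \<le> length ?s" "active (take i ?s) (drop i ?s)" by auto
    moreover have "take i ?s @ drop i ?s = ?s" by (rule append_take_drop_id)
    ultimately have "length P \<le> i \<and> i \<le> length (P @ W)"
      using assms unfolding window_def by (metis length_take min.absorb2)
    then show "i \<in> (+) (length P) ` {..length W}"
      by (intro image_eqI[of _ _ "i - length P"]) auto
  next
    fix i assume "i \<in> (+) (length P) ` {..length W}"
    then have i: "length P \<le> i" "i \<le> length (P @ W)" by auto
    moreover from i have "i \<le> length ?s" by simp
    moreover have "take i ?s @ drop i ?s = ?s" by (rule append_take_drop_id)
    ultimately show "i \<in> {i. i \<le> length ?s \<and> active (take i ?s) (drop i ?s)}"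
      using assms unfolding window_def by (metis (mono_tags, lifting) length_take mem_Collect_eq min.absorb2)
  qed
  then show ?thesis
    by (simp add: sum.reindex walk_eq_sum child_def)
qed

lemma append_eq_append_leE:
  assumes "xs @ ys = as @ bs" "length as \<le> length xs"
  obtains cs where "xs = as @ cs" "bs = cs @ ys"
  using assms by (auto simp: append_eq_append_conv2)

text \<open>
  The run \<open>U\<close> is the longest decreasing one ending at the site, since an ascent in front of \<open>N\<close> makes a
  123; the factor \<open>R\<close> is cut off at the first element that is the 2 of a 132 with \<open>N\<close> as its 3.
\<close>

lemma window_insert_max:
  assumes win: "window P (L @ U @ R @ Y) Q"
    and U: "dec U" and L: "L \<noteq> [] \<Longrightarrow> U \<noteq> [] \<and> last L < hd U"
    and R: "\<forall>x\<in>set (P @ L @ U). \<forall>y\<in>set R. y < x"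
    and Y: "Y \<noteq> [] \<Longrightarrow> \<exists>x\<in>set (P @ L @ U). x < hd Y"
  defines "N \<equiv> Suc (length (P @ L @ U @ R @ Y @ Q))"
  shows "window (P @ L) (U @ N # R) (Y @ Q)"
  unfolding window_def
proof (intro conjI allI impI)
  have lt: "\<forall>x\<in>set (P @ L @ U @ R @ Y @ Q). x < N"
    using win unfolding window_def N_def by (auto simp: less_Suc_eq_le)
  show "\<forall>x\<in>set ((P @ L) @ (U @ N # R) @ Y @ Q). x \<le> length ((P @ L) @ (U @ N # R) @ Y @ Q)"
  proof (intro ballI)
    fix x assume "x \<in> set ((P @ L) @ (U @ N # R) @ Y @ Q)"
    with lt have "x \<le> N" by (auto intro: less_imp_le)
    then show "x \<le> length ((P @ L) @ (U @ N # R) @ Y @ Q)" by (simp add: N_def)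
  qed
  have act: "active xs ys \<longleftrightarrow> length P \<le> length xs \<and> length xs \<le> length (P @ L @ U @ R @ Y)"
    if "xs @ ys = P @ L @ U @ R @ Y @ Q" for xs ys
    using win that unfolding window_def by auto
  fix xs ys assume eq: "xs @ ys = (P @ L) @ (U @ N # R) @ Y @ Q"
  then have "xs @ ys = (P @ L @ U) @ N # R @ Y @ Q" by simp
  then obtain us where us: "xs = (P @ L @ U) @ us \<and> us @ ys = N # R @ Y @ Q \<or>
      xs @ us = P @ L @ U \<and> ys = us @ N # R @ Y @ Q"
    unfolding append_eq_append_conv2 by blast
  consider zs where "P @ L @ U = xs @ zs" "ys = zs @ N # R @ Y @ Q"
    | zs where "xs = P @ L @ U @ N # zs" "R @ Y @ Q = zs @ ys"
  proof (cases us)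
    case Nil
    with us show ?thesis by (intro that(1)[of "[]"]) auto
  next
    case (Cons n zs)
    with us consider "xs @ us = P @ L @ U" "ys = us @ N # R @ Y @ Q"
      | "xs = P @ L @ U @ N # zs" "zs @ ys = R @ Y @ Q" by auto
    then show ?thesis
    proof cases
      case 1
      from that(1)[OF 1(1)[symmetric] 1(2)] show ?thesis .
    next
      case 2
      from that(2)[OF 2(1) 2(2)[symmetric]] show ?thesis .
    qed
  qed
  then show "active xs ys \<longleftrightarrow> length (P @ L) \<le> length xs \<and> length xs \<le> length ((P @ L) @ U @ N # R)"
  proof cases
    case 1
    have app: "xs @ zs @ R @ Y @ Q = P @ L @ U @ R @ Y @ Q" using 1(1) by (metis append.assoc)
    have "set zs \<subseteq> set (P @ L @ U)" using 1(1) by simp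
    with lt have "\<forall>x\<in>set (zs @ R @ Y @ Q). x < N" by auto
    \<comment> \<open>Left of \<open>N\<close>, only a 123 ending in \<open>N\<close> can be new, so
      the question is whether \<open>zs\<close>, the part between the site and \<open>N\<close>, has
      an ascent.\<close>
    from no123_insert_max[OF this] have "active xs ys \<longleftrightarrow> active xs (zs @ R @ Y @ Q) \<and> sorted_wrt (\<ge>) zs"
      unfolding active_def 1 by auto
    also have "\<dots> \<longleftrightarrow> length P \<le> length xs \<and> sorted_wrt (\<ge>) zs"
      using act[OF app] arg_cong[OF 1(1), of length] by auto
    also have "\<dots> \<longleftrightarrow> length (P @ L) \<le> length xs"
    proof (cases "length (P @ L) \<le> length xs")
      case True
      with 1(1) obtain as where "U = as @ zs"
        using append_eq_append_leE[of xs zs "P @ L" U] by auto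
      with U have "sorted_wrt (>) zs" by (simp add: sorted_wrt_append)
      then have "sorted_wrt (\<ge>) zs" by (rule sorted_wrt_mono_rel[rotated]) simp
      with True show ?thesis by simp
    next
      case False
      then have "L \<noteq> [] \<or> length xs < length P" by auto
      moreover have "\<not> sorted_wrt (\<ge>) zs" if "length P \<le> length xs"
      proof -
        have "L \<noteq> []" using False that by auto
        with L obtain u Us where u: "U = u # Us" "last L < u" by (cases U) auto
        from 1(1) that obtain as where as: "xs = P @ as" "L @ U = as @ zs"
          using append_eq_append_leE[of xs zs P "L @ U"] by auto
        then have len: "length as < length L" using False by simp
        \<comment> \<open>The site lies inside \<open>L\<close>, so \<open>zs\<close> contains the
          ascent from \<open>last L\<close> to \<open>u\<close>.\<close>
        obtain bs where bs: "L = as @ bs" "zs = bs @ U"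
          using as(2) less_imp_le[OF len] by (rule append_eq_append_leE)
        with len have "bs \<noteq> []" by auto
        with bs have "zs = butlast bs @ last L # u # Us" using u by simp
        then show ?thesis using u(2) by (simp add: sorted_wrt_append)
      qed
      ultimately show ?thesis using False by auto
    qed
    finally show ?thesis using arg_cong[OF 1(1), of length] by auto
  next
    case 2
    have app: "(P @ L @ U @ zs) @ ys = P @ L @ U @ R @ Y @ Q" using 2(2) by simp
    have "set zs \<subseteq> set (R @ Y @ Q)" using 2(2) by simp
    with lt have "\<forall>x\<in>set ((P @ L @ U) @ zs). x < N" by auto
    \<comment> \<open>Right of \<open>N\<close>, only a 132 with \<open>N\<close> as its 3 and its 2
      in \<open>zs\<close> can be new.\<close>
    from no132_insert_max[OF this]
    have "active xs ys \<longleftrightarrow> active (P @ L @ U @ zs) ys \<and> (\<forall>x\<in>set (P @ L @ U). \<forall>y\<in>set zs. y \<le> x)"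
      unfolding active_def 2 by auto
    also have "\<dots> \<longleftrightarrow> length zs \<le> length (R @ Y) \<and> (\<forall>x\<in>set (P @ L @ U). \<forall>y\<in>set zs. y \<le> x)"
      using act[OF app] by auto
    also have "\<dots> \<longleftrightarrow> length zs \<le> length R"
    proof (cases "length zs \<le> length R")
      case True
      with 2(2) obtain cs where "R = zs @ cs"
        using append_eq_append_leE[of R "Y @ Q" zs ys] by auto
      then have "set zs \<subseteq> set R" by simp
      with True R show ?thesis by (auto intro: less_imp_le)
    next
      case False
      then have len: "length R < length zs" by simp
      obtain as where as: "zs = R @ as" "Y @ Q = as @ ys"
        using 2(2)[symmetric] less_imp_le[OF len] by (rule append_eq_append_leE)
      with len have "as \<noteq> []" by auto
      show ?thesis
      proof (cases "Y = []")
        case True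
        then show ?thesis using as len by auto
      next
        case False
        \<comment> \<open>A site beyond \<open>R\<close> has passed \<open>hd Y\<close>, which
          completes such a 132.\<close>
        then have "hd Y \<in> set as" using as \<open>as \<noteq> []\<close> by (metis hd_append2 hd_in_set)
        then have "hd Y \<in> set zs" using as by simp
        with Y[OF False] show ?thesis using len by fastforce
      qed
    qed
    finally show ?thesis using 2(1) by auto
  qed
qed

section \<open>Labels and node types\<close>

primrec blocks :: "nat list \<Rightarrow> nat list \<Rightarrow> bool" where
  "blocks [] R \<longleftrightarrow> R = []"
| "blocks (d # E) R \<longleftrightarrow> (\<exists>D t R'. R = D @ t # R' \<and> length D = d \<and> dec D \<and> (\<forall>x\<in>set D. x < t) \<and>
     (\<forall>x\<in>set (D @ [t]). \<forall>y\<in>set R'. y < x) \<and> blocks E R')"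

text \<open>For a site inside a run, the factor kept to its right is the rest of the run, a skew sum
  of single elements; hence the labels \<open>replicate n 0\<close> in \<open>crun\<close> and
  \<open>brun\<close>.\<close>

lemma blocks_dec: "dec D \<Longrightarrow> blocks (replicate (length D) 0) D"
  by (induction D) auto

text \<open>
  The three kinds of nodes. In \<open>bstate\<close> nothing precedes the window. Otherwise the window is
  either a single element (\<open>zstate\<close>) or the run of its first block starts with an element \<open>a\<close> that
  does not lie below \<open>P\<close>, whereas the remaining \<open>v\<close> elements \<open>V\<close> of that run do (\<open>cstate\<close>).
\<close>

definition zstate :: "nat list \<Rightarrow> nat list \<Rightarrow> nat list \<Rightarrow> bool" where
  "zstate P W Q \<longleftrightarrow> window P W Q \<and> (\<exists>b. W = [b] \<and> (\<exists>p\<in>set P. p < b))"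

definition cstate :: "nat \<Rightarrow> nat list \<Rightarrow> nat list \<Rightarrow> nat list \<Rightarrow> nat list \<Rightarrow> bool" where
  "cstate v E P W Q \<longleftrightarrow> window P W Q \<and> (\<exists>a V b R. W = a # V @ b # R \<and> length V = v \<and> dec (a # V) \<and>
     (\<exists>p\<in>set P. p < a) \<and> a < b \<and> (\<forall>x\<in>set P. \<forall>y\<in>set V. y < x) \<and>
     blocks E R \<and> (\<forall>x\<in>set (P @ a # V @ [b]). \<forall>y\<in>set R. y < x))"

definition bstate :: "nat list \<Rightarrow> nat list \<Rightarrow> nat list \<Rightarrow> bool" where
  "bstate E W Q \<longleftrightarrow> window [] W Q \<and> blocks E W"

section \<open>Children at one site and summed over sites\<close>

definition czcount :: "nat \<Rightarrow> bool" where
  "czcount n \<longleftrightarrow> (\<forall>P W Q. (zstate P W Q \<longrightarrow> real (descendants n (P @ W @ Q)) = zgf $ n) \<and>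
     (\<forall>v E. cstate v E P W Q \<longrightarrow> real (descendants n (P @ W @ Q)) = cgf v E $ n))"

text \<open>Kept apart from \<open>czcount\<close>: z and c nodes produce each other but never a b
  node, so their counts are settled first and then used for b nodes.\<close>

definition bcount :: "nat \<Rightarrow> bool" where
  "bcount n \<longleftrightarrow> (\<forall>E W Q. bstate E W Q \<longrightarrow> real (descendants n (W @ Q)) = bgf E $ n)"

text \<open>At the left end of the window the next entry already exceeds an entry of
  \<open>P\<close>, so it is cut off and the new maximum alone forms the window.\<close>

lemma child_zgf:
  assumes "czcount n" "window P (y # Y) Q" "\<exists>p\<in>set P. p < y"
  shows "child n P Q [] (y # Y) = zgf $ n"
proof -
  let ?N = "Suc (length (P @ (y # Y) @ Q))"
  have "window P [?N] (y # Y @ Q)"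
    using window_insert_max[of P "[]" "[]" "[]" "y # Y" Q] assms by simp
  moreover have "\<exists>p\<in>set P. p < ?N"
    using assms(2,3) unfolding window_def by (auto simp: less_Suc_eq_le)
  ultimately have "zstate P [?N] (y # Y @ Q)" by (simp add: zstate_def)
  with assms(1) have "real (descendants n (P @ [?N] @ y # Y @ Q)) = zgf $ n"
    unfolding czcount_def by blast
  then show ?thesis by (simp add: child_def insert_max_def)
qed

text \<open>The run \<open>u # Us\<close> ending at the site, topped by the new maximum, opens the
  new window; \<open>L\<close> joins the prefix and \<open>Y\<close> the suffix.\<close>

lemma child_cgf:
  assumes "czcount n" "window P W Q" "W = L @ u # Us @ R @ Y"
    and "dec (u # Us)" "L \<noteq> [] \<Longrightarrow> last L < u" "\<exists>p\<in>set (P @ L). p < u"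
    and "\<forall>x\<in>set (P @ L). \<forall>y\<in>set Us. y < x" "blocks E R"
    and "\<forall>x\<in>set (P @ L @ u # Us). \<forall>y\<in>set R. y < x"
    and "Y \<noteq> [] \<Longrightarrow> \<exists>x\<in>set (P @ L @ u # Us). x < hd Y"
  shows "child n P Q (L @ u # Us) (R @ Y) = cgf (length Us) E $ n"
proof -
  let ?N = "Suc (length (P @ L @ (u # Us) @ R @ Y @ Q))"
  have lt: "\<forall>x\<in>set (P @ W @ Q). x < ?N"
    using assms(2,3) unfolding window_def by (auto simp: less_Suc_eq_le)
  have "window (P @ L) ((u # Us) @ ?N # R) (Y @ Q)"
    using assms by (intro window_insert_max) auto
  moreover have "u < ?N" "\<forall>y\<in>set R. y < ?N"
    using lt assms(3) by auto
  moreover from this(2) have "\<forall>x\<in>set ((P @ L) @ u # Us @ [?N]). \<forall>y\<in>set R. y < x"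
    using assms(9) by auto
  ultimately have "cstate (length Us) E (P @ L) ((u # Us) @ ?N # R) (Y @ Q)"
    unfolding cstate_def using assms(4,6,7,8)
    by (intro conjI exI[of _ u] exI[of _ Us] exI[of _ ?N] exI[of _ R]) simp_all
  with assms(1) have "real (descendants n ((P @ L) @ ((u # Us) @ ?N # R) @ Y @ Q)) = cgf (length Us) E $ n"
    unfolding czcount_def by blast
  then show ?thesis by (simp add: child_def insert_max_def)
qed

lemma child_bgf:
  assumes "bcount n" "window [] W Q" "W = U @ R @ Y"
    and "dec U" "blocks E R" "\<forall>x\<in>set U. \<forall>y\<in>set R. y < x"
    and "Y \<noteq> [] \<Longrightarrow> \<exists>x\<in>set U. x < hd Y"
  shows "child n [] Q U (R @ Y) = bgf (length U # E) $ n"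
proof -
  let ?N = "Suc (length (U @ R @ Y @ Q))"
  have lt: "\<forall>x\<in>set (W @ Q). x < ?N"
    using assms(2,3) unfolding window_def by (auto simp: less_Suc_eq_le)
  have "window [] (U @ ?N # R) (Y @ Q)"
    using window_insert_max[of "[]" "[]" U R Y Q] assms by simp
  then have "bstate (length U # E) (U @ ?N # R) (Y @ Q)"
    unfolding bstate_def blocks.simps using assms lt
    by (intro conjI exI[of _ U] exI[of _ ?N] exI[of _ R]) auto
  with assms(1) have "real (descendants n ((U @ ?N # R) @ Y @ Q)) = bgf (length U # E) $ n"
    unfolding bcount_def by blast
  then show ?thesis by (simp add: child_def insert_max_def)
qed

text \<open>At each site in the run, \<open>t\<close> exceeds an entry to the left, so the kept
  factor stops before \<open>t\<close>.\<close>

lemma walk_crun: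
  assumes "czcount n" "window P W Q" "W = L @ u # Us @ D @ t # Y"
    and "dec (u # Us @ D)" "L \<noteq> [] \<Longrightarrow> last L < u" "\<exists>p\<in>set (P @ L). p < u"
    and "\<forall>x\<in>set (P @ L). \<forall>y\<in>set (Us @ D). y < x" "\<exists>x\<in>set (u # Us). x < t"
  shows "walk (\<lambda>xs ys. child n P Q xs (ys @ t # Y)) (L @ u # Us) D = crun (length Us) (length D) $ n"
  using assms(3-)
proof (induction D arbitrary: Us)
  case Nil
  then have "child n P Q (L @ u # Us) ([] @ t # Y) = cgf (length Us) [] $ n"
    by (intro child_cgf[OF assms(1,2)]) auto
  then show ?case by simp
next
  case (Cons d D)
  have "child n P Q (L @ u # Us) ((d # D) @ t # Y) = cgf (length Us) (replicate (length (d # D)) 0) $ n"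
    using Cons.prems by (intro child_cgf[OF assms(1,2)] blocks_dec) (auto simp: sorted_wrt_append)
  moreover have "walk (\<lambda>xs ys. child n P Q xs (ys @ t # Y)) (L @ u # Us @ [d]) D
      = crun (length (Us @ [d])) (length D) $ n"
    using Cons.prems by (intro Cons.IH) auto
  ultimately show ?case by simp
qed

lemma walk_brun:
  assumes "bcount n" "window [] W Q" "W = U @ D @ t # Y" "dec (U @ D)" "\<exists>x\<in>set U. x < t"
  shows "walk (\<lambda>xs ys. child n [] Q xs (ys @ t # Y)) U D = brun (length U) (length D) $ n"
  using assms(3-)
proof (induction D arbitrary: U)
  case Nil
  then have "child n [] Q U ([] @ t # Y) = bgf (length U # []) $ n"
    by (intro child_bgf[OF assms(1,2)]) auto
  then show ?case by simp
next
  case (Cons d D)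
  have "child n [] Q U ((d # D) @ t # Y) = bgf (length U # replicate (length (d # D)) 0) $ n"
    using Cons.prems by (intro child_bgf[OF assms(1,2)] blocks_dec) (auto simp: sorted_wrt_append)
  moreover have "walk (\<lambda>xs ys. child n [] Q xs (ys @ t # Y)) (U @ [d]) D
      = brun (length (U @ [d])) (length D) $ n"
    using Cons.prems by (intro Cons.IH) auto
  ultimately show ?case by simp
qed

lemma blocks_SucE:
  assumes "blocks (Suc l # E) R"
  obtains d D t R' where "R = d # D @ t # R'" "length D = l" "dec (d # D)" "d < t" "\<forall>x\<in>set D. x < t"
    "\<forall>x\<in>set (d # D @ [t]). \<forall>y\<in>set R'. y < x" "blocks E R'"
  using assms by (auto simp: length_Suc_conv)

text \<open>Scans the blocks of \<open>R\<close>: a single element prolongs the run ending at the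
  site, while the sites inside a nonempty run are handled by \<open>walk_crun\<close>.\<close>

lemma walk_csum:
  assumes "czcount n" "window P W Q" "W = L @ u # Us @ R"
    and "dec (u # Us)" "L \<noteq> [] \<Longrightarrow> last L < u" "\<exists>p\<in>set (P @ L). p < u"
    and "\<forall>x\<in>set (P @ L). \<forall>y\<in>set Us. y < x" "blocks E R"
    and "\<forall>x\<in>set (P @ L @ u # Us). \<forall>y\<in>set R. y < x"
  shows "walk (child n P Q) (L @ u # Us) R = csum (length Us) E $ n"
  using assms(3-)
proof (induction E arbitrary: L u Us R)
  case Nil
  then have "child n P Q (L @ u # Us) ([] @ []) = cgf (length Us) [] $ n"
    by (intro child_cgf[OF assms(1,2)]) auto
  with Nil show ?case by simp
next
  case (Cons e E)
  have 1: "child n P Q (L @ u # Us) (R @ []) = cgf (length Us) (e # E) $ n"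
    using Cons.prems by (intro child_cgf[OF assms(1,2)]) (auto simp del: blocks.simps)
  show ?case
  proof (cases e)
    case 0
    with Cons.prems obtain t R' where R: "R = t # R'" "\<forall>y\<in>set R'. y < t" "blocks E R'" by auto
    have "walk (child n P Q) (L @ u # (Us @ [t])) R' = csum (length (Us @ [t])) E $ n"
      using Cons.prems R by (intro Cons.IH) (auto simp: sorted_wrt_append)
    with 0 1 R show ?thesis by simp
  next
    case (Suc l)
    with Cons.prems obtain d D t R' where R: "R = d # D @ t # R'" "length D = l" "dec (d # D)" "d < t"
      "\<forall>x\<in>set D. x < t" "\<forall>x\<in>set (d # D @ [t]). \<forall>y\<in>set R'. y < x" "blocks E R'"
      by (blast elim: blocks_SucE)
    have 2: "walk (\<lambda>xs ys. child n P Q xs (ys @ t # R')) (L @ u # (Us @ [d])) D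
        = crun (length (Us @ [d])) (length D) $ n"
      using Cons.prems R by (intro walk_crun[OF assms(1,2)]) (auto simp: sorted_wrt_append)
    \<comment> \<open>Just after the top \<open>t\<close> the run ending at the site is
      \<open>[t]\<close>, so \<open>L\<close> absorbs all before it and the counter restarts at
      0.\<close>
    have 3: "walk (child n P Q) ((L @ u # Us @ d # D) @ t # []) R' = csum (length ([] :: nat list)) E $ n"
    proof (rule Cons.IH)
      show "W = (L @ u # Us @ d # D) @ t # [] @ R'" using Cons.prems(1) R(1) by simp
      show "last (L @ u # Us @ d # D) < t" using R(4,5) last_in_set[of D] by auto
      show "\<exists>p\<in>set (P @ L @ u # Us @ d # D). p < t" using R(4) by auto
      have "\<forall>x\<in>set (P @ L @ u # Us). \<forall>y\<in>set R'. y < x" using Cons.prems(7) R(1) by simp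
      with R(6) show "\<forall>x\<in>set (P @ (L @ u # Us @ d # D) @ [t]). \<forall>y\<in>set R'. y < x"
        by (simp add: ball_Un)
    qed (use R(7) in simp_all)
    show ?thesis using Suc 1 2 3 R by (simp add: walk_append)
  qed
qed

lemma walk_bsum:
  assumes "bcount n" "czcount n" "window [] W Q" "W = U @ R"
    and "dec U" "blocks E R" "\<forall>x\<in>set U. \<forall>y\<in>set R. y < x"
  shows "walk (child n [] Q) U R = bsum (length U) E $ n"
  using assms(4-)
proof (induction E arbitrary: U R)
  case Nil
  then have "child n [] Q U ([] @ []) = bgf (length U # []) $ n"
    by (intro child_bgf[OF assms(1,3)]) auto
  with Nil show ?case by simp
next
  case (Cons e E)
  have 1: "child n [] Q U (R @ []) = bgf (length U # e # E) $ n"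
    using Cons.prems by (intro child_bgf[OF assms(1,3)]) (auto simp del: blocks.simps)
  show ?case
  proof (cases e)
    case 0
    with Cons.prems obtain t R' where R: "R = t # R'" "\<forall>y\<in>set R'. y < t" "blocks E R'" by auto
    have "walk (child n [] Q) (U @ [t]) R' = bsum (length (U @ [t])) E $ n"
      using Cons.prems R by (intro Cons.IH) (auto simp: sorted_wrt_append)
    with 0 1 R show ?thesis by simp
  next
    case (Suc l)
    with Cons.prems obtain d D t R' where R: "R = d # D @ t # R'" "length D = l" "dec (d # D)" "d < t"
      "\<forall>x\<in>set D. x < t" "\<forall>x\<in>set (d # D @ [t]). \<forall>y\<in>set R'. y < x" "blocks E R'"
      by (blast elim: blocks_SucE)
    have 2: "walk (\<lambda>xs ys. child n [] Q xs (ys @ t # R')) (U @ [d]) D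
        = brun (length (U @ [d])) (length D) $ n"
      using Cons.prems R by (intro walk_brun[OF assms(1,3)]) (auto simp: sorted_wrt_append)
    \<comment> \<open>From here on the discarded part \<open>L\<close> is nonempty, so the children
      are c nodes.\<close>
    have 3: "walk (child n [] Q) ((U @ d # D) @ t # []) R' = csum (length ([] :: nat list)) E $ n"
      using Cons.prems R by (intro walk_csum[OF assms(2,3)]) (auto simp: sorted_wrt_append)
    show ?thesis using Suc 1 2 3 R by (simp add: walk_append)
  qed
qed

section \<open>Induction on the number of insertions\<close>

lemma zgf_nth: "zgf $ 0 = 1" "zgf $ Suc n = zgf $ n + cgf 0 [] $ n"
  by (subst zgf_eq, simp)+

lemma cgf_nth: "cgf v E $ 0 = 1" "cgf v E $ Suc n = zgf $ n + crun 0 v $ n + csum 0 E $ n"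
  by (subst cgf_eq, simp)+

lemma bgf_nth: "bgf E $ 0 = 1" "bgf E $ Suc n = bsum 0 E $ n"
  by (subst bgf_eq, simp)+

lemma czcount: "czcount n"
proof (induction n)
  case 0
  show ?case by (simp add: czcount_def zgf_nth cgf_nth)
next
  case (Suc n)
  show ?case
    unfolding czcount_def
  proof (intro allI conjI impI)
    fix P W Q assume "zstate P W Q"
    then obtain b p where win: "window P W Q" and W: "W = [b]" and p: "p \<in> set P" "p < b"
      unfolding zstate_def by auto
    have 1: "child n P Q [] (b # []) = zgf $ n"
      using win W p by (intro child_zgf[OF Suc]) auto
    have 2: "child n P Q ([] @ b # []) ([] @ []) = cgf (length ([] :: nat list)) [] $ n"
      using W p by (intro child_cgf[OF Suc win]) auto
    show "real (descendants (Suc n) (P @ W @ Q)) = zgf $ Suc n"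
      using 1 2 unfolding descendants_window[OF win] unfolding W by (simp add: zgf_nth)
  next
    fix P W Q v E assume "cstate v E P W Q"
    then obtain a V b R where win: "window P W Q" and W: "W = a # V @ b # R" and V: "length V = v" "dec (a # V)"
      and a: "\<exists>p\<in>set P. p < a" "a < b" and PV: "\<forall>x\<in>set P. \<forall>y\<in>set V. y < x"
      and R: "blocks E R" "\<forall>x\<in>set (P @ a # V @ [b]). \<forall>y\<in>set R. y < x"
      unfolding cstate_def by (elim conjE exE) (rule that)
    \<comment> \<open>The three groups of sites match the summands of \<open>cgf_eq\<close>: before
      \<open>a\<close>, between \<open>a\<close> and \<open>b\<close>, and after
      \<open>b\<close>.\<close>
    have 1: "child n P Q [] (a # V @ b # R) = zgf $ n"
      using win W a by (intro child_zgf[OF Suc]) auto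
    have 2: "walk (\<lambda>xs ys. child n P Q xs (ys @ b # R)) ([] @ a # []) V = crun (length ([] :: nat list)) (length V) $ n"
      using W V a PV by (intro walk_crun[OF Suc win]) auto
    have 3: "walk (child n P Q) ((a # V) @ b # []) R = csum (length ([] :: nat list)) E $ n"
    proof (rule walk_csum[OF Suc win])
      show "last (a # V) < b" using last_in_set[of V] V a(2) by (auto intro: less_trans)
    qed (use W V a PV R in auto)
    show "real (descendants (Suc n) (P @ W @ Q)) = cgf v E $ Suc n"
      using 1 2 3 V unfolding descendants_window[OF win] unfolding W by (simp add: cgf_nth walk_append)
  qed
qed

lemma bcount: "bcount n"
proof (induction n)
  case 0
  show ?case by (simp add: bcount_def bgf_nth)
next
  case (Suc n)
  show ?case
    unfolding bcount_def
  proof (intro allI impI)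
    fix E W Q assume "bstate E W Q"
    then have win: "window [] W Q" and W: "blocks E W" by (auto simp: bstate_def)
    then have "walk (child n [] Q) [] W = bsum (length ([] :: nat list)) E $ n"
      by (intro walk_bsum[OF Suc czcount]) auto
    with descendants_window[OF win] show "real (descendants (Suc n) (W @ Q)) = bgf E $ Suc n"
      by (simp add: bgf_nth)
  qed
qed

lemma descendants_Nil: "real (descendants n []) = bgf [] $ n"
proof -
  \<comment> \<open>The root of the tree is the b node with the empty label.\<close>
  have "bstate [] [] []"
    by (simp add: bstate_def window_def active_def no123_def no132_def)
  then show ?thesis using bcount[of n] unfolding bcount_def by fastforce
qed

theorem theorem1p1:
  fixes z :: "real fps" and P\<^sub>1 :: "real fps"
  defines "z \<equiv> fps_X"
  defines "P\<^sub>1 \<equiv> class_gf (Av {[4,1,2,3], [1,3,2,4]})"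
  shows "P\<^sub>1 =
    (2 - 13 * z + 26 * z^2 - 17 * z^3 + 4 * z^4
       - z * (1 - 2 * z - z^2) * sqrt_one_minus_4z)
    / (2 * sqrt_one_minus_4z * (1 - 3 * z + z^2)^2)"
proof -
  have "P\<^sub>1 = bgf []"
    \<comment> \<open>\<open>fps_nth_inverse\<close> identifies a series with the series of its
      coefficients.\<close>
    unfolding P\<^sub>1_def class_gf_def card_avoiders descendants_Nil fps_nth_inverse ..
  then show ?thesis unfolding z_def bgf_Nil_eq_quotient .
qed

end
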